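(* Every oriented graph $D$ in which, for every vertex $x$, the out-neighbourhood $x^+$ induces a transitive tournament has dichromatic number at most $2$, i.e. $V(D)$ can be partitioned into two sets each inducing an acyclic subdigraph.
   Context: Digraphs are finite, no loops, no parallel arcs; an oriented graph has no digon. $x^+$ is the out-neighbourhood of $x$. A transitive tournament is an acyclic tournament. The dichromatic number of a digraph is the least number of colours in a colouring of its vertices in which every colour class induces a subdigraph with no directed cycle. *)

theory Defs
  imports Main
begin

definition oriented_graph :: "'a set \<Rightarrow> ('a \<times> 'a) set \<Rightarrow> bool" where
  "oriented_graph V A \<longleftrightarrow> finite V \<and> A \<subseteq> V \<times> V \<and>
     (\<forall>x. (x, x) \<notin> A) \<and> (\<forall>x y. (x, y) \<in> A \<longrightarrow> (y, x) \<notin> A)"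

definition out_nbhd :: "('a \<times> 'a) set \<Rightarrow> 'a \<Rightarrow> 'a set" where
  "out_nbhd A x = {y. (x, y) \<in> A}"

definition induced_arcs :: "('a \<times> 'a) set \<Rightarrow> 'a set \<Rightarrow> ('a \<times> 'a) set" where
  "induced_arcs A S = A \<inter> (S \<times> S)"

definition induces_acyclic :: "('a \<times> 'a) set \<Rightarrow> 'a set \<Rightarrow> bool" where
  "induces_acyclic A S \<longleftrightarrow> acyclic (induced_arcs A S)"

definition induces_tournament :: "('a \<times> 'a) set \<Rightarrow> 'a set \<Rightarrow> bool" where
  "induces_tournament A S \<longleftrightarrow>
     (\<forall>x\<in>S. \<forall>y\<in>S. x \<noteq> y \<longrightarrow> (x, y) \<in> A \<or> (y, x) \<in> A)"

definition induces_transitive_tournament :: "('a \<times> 'a) set \<Rightarrow> 'a set \<Rightarrow> bool" where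
  "induces_transitive_tournament A S \<longleftrightarrow> induces_tournament A S \<and> induces_acyclic A S"

definition dichromatic_le :: "'a set \<Rightarrow> ('a \<times> 'a) set \<Rightarrow> nat \<Rightarrow> bool" where
  "dichromatic_le V A k \<longleftrightarrow>
     (\<exists>c :: 'a \<Rightarrow> nat. (\<forall>v\<in>V. c v < k) \<and>
        (\<forall>i<k. induces_acyclic A {v\<in>V. c v = i}))"

end

theory Submission
  imports Defs
begin

text \<open>
  By induction on the number of vertices one shows more: for every vertex \<open>v\<close>, the colouring can be
  chosen so that \<open>v\<close> and all its out-neighbours get the same colour. If some proper nonempty
  set of vertices has no outgoing arc, it is coloured separately from the rest. Otherwise call a set
  of vertices an out-module if its members have the same out-neighbours outside it. A maximal proper
  out-module \<open>B\<close> containing \<open>v\<close> and the maximal out-modules disjoint from \<open>B\<close> partition the vertices.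
  Sending each block to the block of the source of its common out-neighbourhood defines a map \<open>F\<close>.
  By maximality of the blocks, \<open>F\<close> permutes them in a single cycle, and the in-neighbourhood of each
  block is an interval of that cycle. Hence the quotient can be coloured by taking one
  in-neighbourhood \<open>N\<^sup>-[w]\<close> as a colour class, where \<open>w\<close> is the last out-neighbour of \<open>B\<close>. All vertices
  through which a block can be entered lie in the closed out-neighbourhood of a single vertex of the
  block, so the induction hypothesis colours the block with monochromatic entries, and the block
  colourings are combined so that the entries carry the colour of the block in the quotient.
\<close>

section \<open>Acyclicity criteria\<close>

lemma acyclic_if_decreasing:
  fixes m :: "'b \<Rightarrow> nat"
  assumes "\<And>x y. (x, y) \<in> r \<Longrightarrow> m y < m x"
  shows "acyclic r"
proof -
  have "m y < m x" if "(x, y) \<in> r\<^sup>+" for x y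
    using that by (induction rule: trancl.induct) (auto dest: assms intro: less_trans)
  then show ?thesis
    unfolding acyclic_def by blast
qed

text \<open>Every vertex of a cycle of \<open>p\<close> is both a head and a tail, so the whole
  cycle lies in \<open>S\<close>. This serves quotient relations in which an end of an arc may lie
  outside the colour class.\<close>

lemma acyclic_if_inner_acyclic:
  assumes "acyclic (r \<inter> S \<times> S)" "p \<subseteq> r" "Domain p \<inter> Range p \<subseteq> S"
  shows "acyclic p"
proof -
  have "(x, y) \<in> (r \<inter> S \<times> S)\<^sup>+"
    if "(x, y) \<in> p\<^sup>+" "x \<in> Range p" "y \<in> Domain p" for x y
    using that
  proof (induction rule: trancl.induct)
    case (r_into_trancl a b)
    then have "(a, b) \<in> r \<inter> S \<times> S"
      using assms(2,3) by blast
    then show ?case by blast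
  next
    case (trancl_into_trancl a b c)
    then have "(a, b) \<in> (r \<inter> S \<times> S)\<^sup>+" by blast
    moreover have "b \<in> Range p"
      using trancl_into_trancl.hyps(1) by (metis Range.intros tranclD2)
    then have "(b, c) \<in> r \<inter> S \<times> S"
      using assms(2,3) trancl_into_trancl by blast
    ultimately show ?case by (rule trancl.trancl_into_trancl)
  qed
  moreover have "x \<in> Range p \<and> x \<in> Domain p" if "(x, x) \<in> p\<^sup>+" for x
    using that by (metis Domain.intros Range.intros tranclD tranclD2)
  ultimately show ?thesis
    using assms(1) unfolding acyclic_def by blast
qed

text \<open>A walk of \<open>r\<close> stays in one fibre or projects to a walk of positive length
  in \<open>p\<close>. A closed walk would thus give a cycle in a fibre or in
  \<open>p\<close>.\<close>

lemma acyclic_if_fibres_acyclic: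
  assumes "acyclic p"
    and "\<And>b. acyclic (r \<inter> {x. \<pi> x = b} \<times> {x. \<pi> x = b})"
    and cross: "\<And>x y. (x, y) \<in> r \<Longrightarrow> \<pi> x \<noteq> \<pi> y \<Longrightarrow> (\<pi> x, \<pi> y) \<in> p"
  shows "acyclic r"
proof -
  have "(\<pi> x = \<pi> y \<and> (x, y) \<in> (r \<inter> {z. \<pi> z = \<pi> x} \<times> {z. \<pi> z = \<pi> x})\<^sup>+) \<or> (\<pi> x, \<pi> y) \<in> p\<^sup>+"
    if "(x, y) \<in> r\<^sup>+" for x y
    using that
  proof (induction rule: trancl.induct)
    case (r_into_trancl a b)
    then show ?case using cross[of a b] by (cases "\<pi> a = \<pi> b") auto
  next
    case (trancl_into_trancl a b c)
    show ?case
    proof (cases "\<pi> b = \<pi> c")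
      case True
      then show ?thesis
        using trancl_into_trancl
        by (auto intro: trancl.trancl_into_trancl)
    next
      case False
      then have "(\<pi> b, \<pi> c) \<in> p" using cross trancl_into_trancl by blast
      then show ?thesis
        using trancl_into_trancl.IH by (auto intro: trancl.trancl_into_trancl)
    qed
  qed
  then show ?thesis
    using assms(1,2) unfolding acyclic_def by blast
qed

section \<open>Digraphs whose arcs are carried along a single orbit\<close>

lemma carry_along_orbit:
  assumes carry: "\<And>x y. (x, y) \<in> E \<Longrightarrow> y = f x \<or> (f x, y) \<in> E"
    and "(x, y) \<in> E" "\<And>j. j \<le> k \<Longrightarrow> (f ^^ j) x \<noteq> y"
  shows "((f ^^ k) x, y) \<in> E"
  using assms(3)
proof (induction k)
  case 0
  then show ?case using assms(2) by simp
next
  case (Suc k)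
  then have "((f ^^ k) x, y) \<in> E" by simp
  then show ?case using carry Suc.prems[of "Suc k"] by fastforce
qed

text \<open>An arc \<open>(x, y)\<close> shortens the distance along the orbit to every
  \<open>z\<close> that has no arc to \<open>y\<close>. For \<open>y\<close> in the class,
  \<open>z = w\<close> qualifies by asymmetry; for \<open>y\<close> outside, \<open>z = v\<close>
  does, as the class contains all out-neighbours of \<open>v\<close>.\<close>

lemma single_orbit_two_colouring:
  fixes E :: "('b \<times> 'b) set"
  assumes "finite Q" and sub: "E \<subseteq> Q \<times> Q"
    and asym: "\<And>x y. (x, y) \<in> E \<Longrightarrow> (y, x) \<notin> E"
    and succ: "\<And>x. x \<in> Q \<Longrightarrow> (x, f x) \<in> E"
    and carry: "\<And>x y. (x, y) \<in> E \<Longrightarrow> y = f x \<or> (f x, y) \<in> E"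
    and orbit: "\<And>x y. x \<in> Q \<Longrightarrow> y \<in> Q \<Longrightarrow> \<exists>k. (f ^^ k) x = y"
    and "v \<in> Q"
  shows "\<exists>S\<subseteq>Q. v \<in> S \<and> out_nbhd E v \<subseteq> S \<and> induces_acyclic E S \<and> induces_acyclic E (Q - S)"
proof -
  define d where "d x y = (LEAST k. (f ^^ k) x = y)" for x y
  have d: "(f ^^ d x y) x = y" if "x \<in> Q" "y \<in> Q" for x y
    unfolding d_def using orbit[OF that] by (rule LeastI_ex)
  have d_le: "d x y \<le> k" if "(f ^^ k) x = y" for x y k
    unfolding d_def using that by (rule Least_le)
  \<comment> \<open>An arc from \<open>x\<close> to a vertex \<open>y\<close> not met by the orbit before \<open>z\<close> would be carried along to \<open>z\<close>.\<close>
  have approach: "d y z < d x z"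
    if "(x, y) \<in> E" "z \<in> Q" "(z, y) \<notin> E" for x y z
  proof -
    have "x \<in> Q" using that sub by blast
    have "(f ^^ d x z) x = z" using d \<open>x \<in> Q\<close> that by blast
    then obtain j where j: "j \<le> d x z" "(f ^^ j) x = y"
      using carry_along_orbit[of E f x y "d x z", OF carry \<open>(x, y) \<in> E\<close>] \<open>(z, y) \<notin> E\<close> by auto
    \<comment> \<open>There are no loops, so at least one step is spent before \<open>y\<close> is
      reached; this makes the inequality strict.\<close>
    have "j \<noteq> 0" using j that asym by (metis funpow_0)
    have "(f ^^ (d x z - j)) y = z"
      using j \<open>(f ^^ d x z) x = z\<close> by (metis comp_apply funpow_add le_add_diff_inverse2)
    then have "d y z \<le> d x z - j" by (rule d_le)
    then show ?thesis using j \<open>j \<noteq> 0\<close> by linarith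
  qed
  have fin: "finite (out_nbhd E v)" and "out_nbhd E v \<noteq> {}"
    using sub \<open>finite Q\<close> succ[OF \<open>v \<in> Q\<close>] by (auto simp: out_nbhd_def intro: finite_subset)
  then have "Max (d v ` out_nbhd E v) \<in> d v ` out_nbhd E v" by (intro Max_in) auto
  then obtain w where w: "w \<in> out_nbhd E v" and w_Max: "d v w = Max (d v ` out_nbhd E v)"
    by auto
  have w_max: "d v y \<le> d v w" if "(v, y) \<in> E" for y
    unfolding w_Max using fin that by (auto simp: out_nbhd_def)
  have "w \<in> Q" "(v, w) \<in> E" using w sub by (auto simp: out_nbhd_def)
  define S where "S = insert w {x. (x, w) \<in> E}"
  have "y \<in> S" if "(v, y) \<in> E" for y
  proof (cases "y = w")
    case False
    have "y \<in> Q" using that sub by blast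
    \<comment> \<open>Reaching \<open>w\<close> no later than \<open>y\<close> would force equal
      distances from \<open>v\<close>, since \<open>w\<close> is farthest, and hence
      \<open>y = w\<close>. So the arc from \<open>v\<close> to \<open>w\<close> is carried as far
      as \<open>y\<close>.\<close>
    have "(f ^^ j) v \<noteq> w" if "j \<le> d v y" for j
    proof
      assume "(f ^^ j) v = w"
      then have "d v w \<le> d v y" using d_le that le_trans by blast
      then have "d v w = d v y" using w_max[OF \<open>(v, y) \<in> E\<close>] by simp
      then show False
        using False d[OF \<open>v \<in> Q\<close>] \<open>y \<in> Q\<close> \<open>w \<in> Q\<close> by metis
    qed
    then have "((f ^^ d v y) v, w) \<in> E"
      by (intro carry_along_orbit[of E f v w, OF carry \<open>(v, w) \<in> E\<close>])
    then show ?thesis using d \<open>v \<in> Q\<close> \<open>y \<in> Q\<close> by (simp add: S_def)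
  qed (simp add: S_def)
  then have out: "out_nbhd E v \<subseteq> S" by (auto simp: out_nbhd_def)
  have "induces_acyclic E S"
    unfolding induces_acyclic_def
  proof (rule acyclic_if_decreasing[where m = "\<lambda>x. d x w"])
    fix x y assume "(x, y) \<in> induced_arcs E S"
    then have "(x, y) \<in> E" "y \<in> S" by (auto simp: induced_arcs_def)
    then have "(w, y) \<notin> E" using asym by (auto simp: S_def)
    then show "d y w < d x w" using approach \<open>(x, y) \<in> E\<close> \<open>w \<in> Q\<close> by blast
  qed
  moreover have "induces_acyclic E (Q - S)"
    unfolding induces_acyclic_def
  proof (rule acyclic_if_decreasing[where m = "\<lambda>x. d x v"])
    fix x y assume "(x, y) \<in> induced_arcs E (Q - S)"
    then have "(x, y) \<in> E" "y \<notin> S" by (auto simp: induced_arcs_def)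
    then show "d y v < d x v" using approach out \<open>v \<in> Q\<close> by (auto simp: out_nbhd_def)
  qed
  moreover have "S \<subseteq> Q" "v \<in> S" using sub \<open>w \<in> Q\<close> \<open>(v, w) \<in> E\<close> by (auto simp: S_def)
  ultimately show ?thesis using out by blast
qed

section \<open>Out-modules and the statement for the induction\<close>

lemma induces_acyclic_subset:
  "induces_acyclic A T \<Longrightarrow> S \<subseteq> T \<Longrightarrow> induces_acyclic A S"
  unfolding induces_acyclic_def induced_arcs_def by (rule acyclic_subset) auto

text \<open>Only out-neighbours in \<open>S\<close> count, because the induction shrinks
  \<open>S\<close> and keeps \<open>A\<close>. Since \<open>x\<close> and \<open>x'\<close> may be
  exchanged, the implication amounts to equality.\<close>

definition out_module :: "('a \<times> 'a) set \<Rightarrow> 'a set \<Rightarrow> 'a set \<Rightarrow> bool" where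
  "out_module A S M \<longleftrightarrow> M \<subseteq> S \<and> M \<noteq> {} \<and>
     (\<forall>x\<in>M. \<forall>x'\<in>M. \<forall>y\<in>S - M. (x, y) \<in> A \<longrightarrow> (x', y) \<in> A)"

text \<open>An out-neighbour of \<open>a\<close> outside the union is one of the shared vertex
  \<open>x\<close>, by the module of \<open>a\<close>, and then one of \<open>b\<close>, by the
  module of \<open>b\<close>.\<close>

lemma out_module_Union:
  assumes "\<And>M. M \<in> \<M> \<Longrightarrow> out_module A S M \<and> x \<in> M" "\<M> \<noteq> {}"
  shows "out_module A S (\<Union>\<M>)"
  unfolding out_module_def
proof (intro conjI ballI impI)
  show "\<Union>\<M> \<subseteq> S" using assms(1) unfolding out_module_def by blast
  show "\<Union>\<M> \<noteq> {}" using assms by blast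
  fix a b y assume a: "a \<in> \<Union>\<M>" "b \<in> \<Union>\<M>" "y \<in> S - \<Union>\<M>" "(a, y) \<in> A"
  then obtain M N where MN: "M \<in> \<M>" "a \<in> M" "N \<in> \<M>" "b \<in> N" by blast
  then have "(x, y) \<in> A" using a assms(1)[of M] unfolding out_module_def by blast
  then show "(b, y) \<in> A" using a MN assms(1)[of N] unfolding out_module_def by blast
qed

text \<open>No vertex set is mentioned, so the conditions stay available for every subset
  \<open>S\<close> met in the induction.\<close>

locale out_transitive =
  fixes A :: "('a \<times> 'a) set"
  assumes asym: "(x, y) \<in> A \<Longrightarrow> (y, x) \<notin> A"
    and out_tt: "induces_transitive_tournament A (out_nbhd A x)"
begin

text \<open>A finite acyclic relation is well-founded; a minimal vertex receives no arc from
  \<open>T\<close>, so in a tournament it sends one to every other vertex.\<close>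

lemma source_exists:
  assumes "finite T" "T \<noteq> {}" "T \<subseteq> out_nbhd A x"
  shows "\<exists>s\<in>T. \<forall>y\<in>T. y = s \<or> (s, y) \<in> A"
proof -
  have "acyclic (induced_arcs A T)"
    using out_tt[of x] induces_acyclic_subset assms(3)
    unfolding induces_transitive_tournament_def induces_acyclic_def by blast
  moreover have "finite (induced_arcs A T)"
    unfolding induced_arcs_def using assms(1) by blast
  ultimately have "wf (induced_arcs A T)" by (simp add: finite_acyclic_wf)
  then obtain s where s: "s \<in> T" "\<And>y. (y, s) \<in> induced_arcs A T \<Longrightarrow> y \<notin> T"
    using assms(2) by (metis ex_in_conv wfE_min)
  have "y = s \<or> (s, y) \<in> A" if "y \<in> T" for y
    using s that assms(3) out_tt[of x]
    unfolding induces_transitive_tournament_def induces_tournament_def induced_arcs_def by blast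
  then show ?thesis using s(1) by blast
qed

definition splits :: "'a set \<Rightarrow> 'a \<Rightarrow> 'a set \<Rightarrow> bool" where
  "splits S v T \<longleftrightarrow> T \<subseteq> S \<and> v \<in> T \<and> out_nbhd A v \<inter> S \<subseteq> T \<and>
     induces_acyclic A T \<and> induces_acyclic A (S - T)"

text \<open>Arcs between the two parts only lead into \<open>C\<close>, so no cycle meets both and
  their colourings combine freely. Only the out-neighbours of \<open>v\<close> need care.\<close>

lemma splits_closed:
  assumes "finite S" "C \<subset> S" "C \<noteq> {}" and closed: "\<And>x y. x \<in> C \<Longrightarrow> y \<in> S - C \<Longrightarrow> (x, y) \<notin> A"
    and IH: "\<And>S' u. S' \<subset> S \<Longrightarrow> u \<in> S' \<Longrightarrow> \<exists>T. splits S' u T"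
    and "v \<in> S"
  shows "\<exists>T. splits S v T"
proof -
  have acyc: "induces_acyclic A (T1 \<union> T2)"
    if "induces_acyclic A T1" "induces_acyclic A T2" "T1 \<subseteq> C" "T2 \<subseteq> S - C" for T1 T2
    unfolding induces_acyclic_def
  proof (rule acyclic_if_fibres_acyclic[where p = "{(False, True)}" and \<pi> = "\<lambda>x. x \<in> C"])
    show "acyclic {(False, True)}" by (rule acyclic_if_decreasing[where m = "\<lambda>b. if b then 0 else 1"]) auto
    show "acyclic (induced_arcs A (T1 \<union> T2) \<inter> {x. (x \<in> C) = b} \<times> {x. (x \<in> C) = b})" for b
    proof (cases b)
      case True
      show ?thesis
        by (rule acyclic_subset[OF that(1)[unfolded induces_acyclic_def]])
          (use True that in \<open>auto simp: induced_arcs_def\<close>)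
    next
      case False
      show ?thesis
        by (rule acyclic_subset[OF that(2)[unfolded induces_acyclic_def]])
          (use False that in \<open>auto simp: induced_arcs_def\<close>)
    qed
    show "(x \<in> C, y \<in> C) \<in> {(False, True)}"
      if "(x, y) \<in> induced_arcs A (T1 \<union> T2)" "(x \<in> C) \<noteq> (y \<in> C)" for x y
      using that closed[of x y] \<open>T1 \<subseteq> C\<close> \<open>T2 \<subseteq> S - C\<close> by (auto simp: induced_arcs_def)
  qed
  \<comment> \<open>For \<open>v\<close> outside \<open>C\<close>, the source of its out-neighbours
    in \<open>C\<close> is chosen, if there are any: the class of \<open>u\<close> in
    \<open>C\<close> then contains them all.\<close>
  obtain u where u: "u \<in> C" "v \<in> C \<longrightarrow> u = v" "\<And>y. v \<notin> C \<Longrightarrow> y \<in> out_nbhd A v \<inter> C \<Longrightarrow> y = u \<or> (u, y) \<in> A"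
  proof (cases "v \<in> C \<or> out_nbhd A v \<inter> C = {}")
    case True
    then show ?thesis using that \<open>C \<noteq> {}\<close> by (metis all_not_in_conv)
  next
    case False
    moreover have "finite (out_nbhd A v \<inter> C)" using assms(1,2) by (meson finite_Int finite_subset psubsetE)
    ultimately show ?thesis using that source_exists[of "out_nbhd A v \<inter> C" v] by blast
  qed
  obtain u' where u': "u' \<in> S - C" "v \<notin> C \<longrightarrow> u' = v" using assms(2,6) by blast
  obtain T1 T2 where T: "splits C u T1" "splits (S - C) u' T2"
    using IH[of C u] IH[of "S - C" u'] assms(2,3) u u' by blast
  have "S - (T1 \<union> T2) = (C - T1) \<union> ((S - C) - T2)"
    using T \<open>C \<subset> S\<close> unfolding splits_def by blast
  then have "induces_acyclic A (T1 \<union> T2)" "induces_acyclic A (S - (T1 \<union> T2))"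
    using T acyc[of T1 T2] acyc[of "C - T1" "S - C - T2"] unfolding splits_def by auto
  moreover have "out_nbhd A v \<inter> S \<subseteq> T1 \<union> T2"
  proof
    fix y assume y: "y \<in> out_nbhd A v \<inter> S"
    show "y \<in> T1 \<union> T2"
    proof (cases "v \<in> C")
      case True
      then have "y \<in> C" using y closed by (auto simp: out_nbhd_def)
      then show ?thesis using True y T u unfolding splits_def by blast
    next
      case False
      then show ?thesis using u(3)[of y] u' y T unfolding splits_def out_nbhd_def by blast
    qed
  qed
  moreover have "v \<in> T1 \<union> T2" "T1 \<union> T2 \<subseteq> S"
    using T u(2) u'(2) \<open>C \<subset> S\<close> unfolding splits_def by auto
  ultimately have "splits S v (T1 \<union> T2)" by (simp add: splits_def)
  then show ?thesis ..
qed

lemma splits_strong: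
  assumes "finite S" "v \<in> S" "S \<noteq> {v}"
    and strong: "\<And>C. C \<subset> S \<Longrightarrow> C \<noteq> {} \<Longrightarrow> \<exists>x\<in>C. \<exists>y\<in>S - C. (x, y) \<in> A"
    and IH: "\<And>S' u. S' \<subset> S \<Longrightarrow> u \<in> S' \<Longrightarrow> \<exists>T. splits S' u T"
  shows "\<exists>T. splits S v T"
proof -

  \<comment> \<open>Partition into maximal out-modules\<close>
  have single: "out_module A S {x}" if "x \<in> S" for x
    using that by (simp add: out_module_def)
  have "finite {M. out_module A S M \<and> v \<in> M \<and> M \<noteq> S}"
    using \<open>finite S\<close> by (rule finite_subset[rotated, OF finite_Pow_iff[THEN iffD2]]) (auto simp: out_module_def)
  \<comment> \<open>\<open>S \<noteq> {v}\<close> makes the singleton a proper out-module, so a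
    maximal one exists.\<close>
  moreover have "{v} \<in> {M. out_module A S M \<and> v \<in> M \<and> M \<noteq> S}"
    using assms(2,3) single by auto
  ultimately obtain B where "B \<in> {M. out_module A S M \<and> v \<in> M \<and> M \<noteq> S}"
    and B_max: "\<forall>M\<in>{M. out_module A S M \<and> v \<in> M \<and> M \<noteq> S}. B \<subseteq> M \<longrightarrow> B = M"
    using finite_has_maximal2 by (metis (no_types, lifting))
  then have B: "out_module A S B" "v \<in> B" "B \<noteq> S" by auto
  \<comment> \<open>By \<open>out_module_Union\<close>, the union is the largest out-module through
    \<open>x\<close> avoiding \<open>B\<close>.\<close>
  define \<pi> where "\<pi> x = (if x \<in> B then B else \<Union>{M. out_module A S M \<and> x \<in> M \<and> M \<inter> B = {}})" for x
  have \<pi>_self: "x \<in> \<pi> x" if "x \<in> S" for x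
    using single[OF that] unfolding \<pi>_def by auto
  have \<pi>_module: "out_module A S (\<pi> x)" if "x \<in> S" for x
  proof (cases "x \<in> B")
    case False
    then show ?thesis
      using out_module_Union[of "{M. out_module A S M \<and> x \<in> M \<and> M \<inter> B = {}}" A S x] single[OF that]
      unfolding \<pi>_def by auto
  qed (use B in \<open>simp add: \<pi>_def\<close>)
  have \<pi>_sub: "\<pi> x \<subseteq> S" if "x \<in> S" for x
    using \<pi>_module[OF that] by (simp add: out_module_def)
  have \<pi>_disj: "\<pi> x \<inter> B = {}" if "x \<notin> B" for x
    using that by (auto simp: \<pi>_def)
  have \<pi>_max: "M \<subseteq> \<pi> x" if "out_module A S M" "x \<in> M" "M \<inter> B = {}" for M x
    using that by (auto simp: \<pi>_def)
  \<comment> \<open>Maximality is used both ways: \<open>\<pi> x\<close> competes for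
    \<open>y\<close>, and then \<open>\<pi> y\<close>, which contains \<open>x\<close>, competes for
    \<open>x\<close>.\<close>
  have \<pi>_eq: "\<pi> y = \<pi> x" if "x \<in> S" "y \<in> \<pi> x" for x y
  proof (cases "x \<in> B")
    case False
    then have "\<pi> x \<subseteq> \<pi> y" using \<pi>_max that \<pi>_disj \<pi>_module by blast
    moreover have "y \<in> S" using that \<pi>_sub by blast
    moreover have "y \<notin> B" using that False \<pi>_disj by blast
    ultimately have "\<pi> y \<subseteq> \<pi> x"
      using \<pi>_max[of "\<pi> y" x] \<pi>_disj \<pi>_module \<pi>_self[OF \<open>x \<in> S\<close>] by blast
    then show ?thesis using \<open>\<pi> x \<subseteq> \<pi> y\<close> by blast
  qed (use that in \<open>simp add: \<pi>_def\<close>)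
  have \<pi>_v: "\<pi> v = B" using B by (simp add: \<pi>_def)
  have \<pi>_proper: "\<pi> x \<subset> S" if "x \<in> S" for x
  proof (cases "x \<in> B")
    case True
    then show ?thesis using B \<pi>_sub[OF that] by (auto simp: \<pi>_def)
  next
    case False
    then show ?thesis using \<pi>_disj B \<open>v \<in> S\<close> \<pi>_sub[OF that] by blast
  qed
  \<comment> \<open>The quotient is prime: if \<open>U\<close> misses \<open>B\<close>, maximality
    of the blocks makes it a single block; if not, it contains \<open>B\<close>, and maximality of
    \<open>B\<close> applies.\<close>
  have prime: "U = S \<or> (\<exists>x\<in>S. U = \<pi> x)"
    if U: "out_module A S U" and sat: "\<And>x. x \<in> U \<Longrightarrow> \<pi> x \<subseteq> U" for U
  proof (cases "U \<inter> B = {}")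
    case True
    obtain x where "x \<in> U" "x \<in> S" using U by (auto simp: out_module_def)
    then show ?thesis using \<pi>_max[OF U _ True] sat by blast
  next
    case False
    then obtain b where "b \<in> U" "b \<in> B" by blast
    then have "B \<subseteq> U" using sat[of b] by (simp add: \<pi>_def)
    then have "U = S \<or> U = B" using B_max U B(2) by blast
    then show ?thesis using \<pi>_v \<open>v \<in> S\<close> by blast
  qed

  \<comment> \<open>The blocks and the map \<open>F\<close>\<close>
  define Q where "Q = \<pi> ` S"
  define R where "R \<beta> = {y \<in> S - \<beta>. \<exists>x\<in>\<beta>. (x, y) \<in> A}" for \<beta>
  have "finite Q" using \<open>finite S\<close> by (simp add: Q_def)
  have "B \<in> Q" using \<pi>_v \<open>v \<in> S\<close> by (auto simp: Q_def)
  have Q_\<pi>: "\<pi> x = \<beta>" if "\<beta> \<in> Q" "x \<in> \<beta>" for \<beta> x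
    using that \<pi>_eq by (auto simp: Q_def)
  have Q_ne: "\<exists>x. x \<in> \<beta>" if "\<beta> \<in> Q" for \<beta>
    using that \<pi>_self by (auto simp: Q_def)
  have Q_proper: "\<beta> \<subset> S" if "\<beta> \<in> Q" for \<beta>
    using that \<pi>_proper by (auto simp: Q_def)
  have R_out: "(x, y) \<in> A" if "\<beta> \<in> Q" "x \<in> \<beta>" "y \<in> R \<beta>" for \<beta> x y
    using that \<pi>_module unfolding Q_def R_def out_module_def by blast
  have R_ne: "R \<beta> \<noteq> {}" if "\<beta> \<in> Q" for \<beta>
    using strong[OF Q_proper[OF that]] Q_ne[OF that] unfolding R_def by blast
  have R_D: "y \<in> S \<and> y \<notin> \<beta> \<and> \<pi> y \<in> Q" if "y \<in> R \<beta>" for y \<beta>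
    using that by (auto simp: R_def Q_def)
  have "\<exists>s\<in>R \<beta>. \<forall>y\<in>R \<beta>. y = s \<or> (s, y) \<in> A" if \<beta>: "\<beta> \<in> Q" for \<beta>
  proof -
    obtain x where "x \<in> \<beta>" using Q_ne[OF \<beta>] by blast
    then have "R \<beta> \<subseteq> out_nbhd A x" using R_out[OF \<beta>] by (auto simp: out_nbhd_def)
    moreover have "finite (R \<beta>)" using \<open>finite S\<close> by (simp add: R_def)
    ultimately show ?thesis using source_exists R_ne[OF \<beta>] by blast
  qed
  then have "\<forall>\<beta>\<in>Q. \<exists>s. s \<in> R \<beta> \<and> (\<forall>y\<in>R \<beta>. y = s \<or> (s, y) \<in> A)" by blast
  then obtain g where g: "\<forall>\<beta>\<in>Q. g \<beta> \<in> R \<beta> \<and> (\<forall>y\<in>R \<beta>. y = g \<beta> \<or> (g \<beta>, y) \<in> A)"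
    using bchoice by metis
  then have g_R: "g \<beta> \<in> R \<beta>" and g_dom: "\<And>y. y \<in> R \<beta> \<Longrightarrow> y = g \<beta> \<or> (g \<beta>, y) \<in> A"
    if "\<beta> \<in> Q" for \<beta>
    using that by auto
  define F where "F \<beta> = \<pi> (g \<beta>)" for \<beta>
  have g_F: "g \<beta> \<in> F \<beta>" "F \<beta> \<in> Q" "g \<beta> \<notin> \<beta>" if "\<beta> \<in> Q" for \<beta>
    using g_R that R_D[of "g \<beta>" \<beta>] \<pi>_self by (auto simp: F_def)
  \<comment> \<open>The source \<open>g \<beta>\<close> lies in \<open>F \<beta>\<close> and has an
    arc to \<open>y\<close>. The vertex \<open>y\<close> itself is followed, not only its block,
    since its position in the block matters for the entries.\<close>
  have R_carry: "\<pi> y = F \<beta> \<or> y \<in> R (F \<beta>)" if "\<beta> \<in> Q" "y \<in> R \<beta>" for \<beta> y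
  proof (cases "y \<in> F \<beta>")
    case True
    then show ?thesis using Q_\<pi> g_F(2) that(1) by blast
  next
    case False
    then have "(g \<beta>, y) \<in> A" using g_dom[OF that] g_F(1)[OF \<open>\<beta> \<in> Q\<close>] by auto
    then show ?thesis using False g_F[OF \<open>\<beta> \<in> Q\<close>] R_D[OF \<open>y \<in> R \<beta>\<close>] unfolding R_def by blast
  qed
  have F_iter: "(F ^^ k) \<beta> \<in> Q" if "\<beta> \<in> Q" for k \<beta>
    using that g_F by (induction k) auto
  have R_orbit: "y \<in> R ((F ^^ k) \<beta>)"
    if "\<beta> \<in> Q" "y \<in> R \<beta>" "\<And>j. j \<le> k \<Longrightarrow> (F ^^ j) \<beta> \<noteq> \<pi> y" for k \<beta> y
  proof -
    \<comment> \<open>For fixed \<open>y\<close>, this relation joins to \<open>\<pi> y\<close>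
      exactly the blocks with out-neighbour \<open>y\<close>.\<close>
    have "((F ^^ k) \<beta>, \<pi> y) \<in> {(\<gamma>, \<delta>). \<gamma> \<in> Q \<and> \<delta> = \<pi> y \<and> y \<in> R \<gamma>}"
      by (rule carry_along_orbit) (use that R_carry g_F in auto)
    then show ?thesis by simp
  qed

  \<comment> \<open>The union of a minimal \<open>F\<close>-closed set of blocks is an out-module, hence everything.\<close>
  have "finite {C. C \<subseteq> Q \<and> C \<noteq> {} \<and> F ` C \<subseteq> C}"
    using \<open>finite Q\<close> by (rule finite_subset[rotated, OF finite_Pow_iff[THEN iffD2]]) auto
  moreover have "Q \<in> {C. C \<subseteq> Q \<and> C \<noteq> {} \<and> F ` C \<subseteq> C}"
    using \<open>B \<in> Q\<close> g_F by auto
  ultimately obtain C where "C \<in> {C. C \<subseteq> Q \<and> C \<noteq> {} \<and> F ` C \<subseteq> C}"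
    and C_min: "\<forall>D\<in>{C. C \<subseteq> Q \<and> C \<noteq> {} \<and> F ` C \<subseteq> C}. D \<subseteq> C \<longrightarrow> C = D"
    using finite_has_minimal2 by (metis (no_types, lifting))
  then have C: "C \<subseteq> Q" "C \<noteq> {}" "F ` C \<subseteq> C" by auto
  have C_minimal: "C = D" if "D \<subseteq> C" "D \<noteq> {}" "F ` D \<subseteq> D" for D
  proof -
    have "D \<in> {C. C \<subseteq> Q \<and> C \<noteq> {} \<and> F ` C \<subseteq> C}" using that C(1) by auto
    then show ?thesis using C_min that(1) by simp
  qed
  have C_iter: "(F ^^ k) \<beta> \<in> C" if "\<beta> \<in> C" for \<beta> k
    using that C(3) by (induction k) auto
  have C_orbit: "\<exists>k. (F ^^ k) \<beta> = \<gamma>" if "\<beta> \<in> C" "\<gamma> \<in> C" for \<beta> \<gamma>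
  proof -
    \<comment> \<open>An orbit is \<open>F\<close>-closed, so by minimality it exhausts
      \<open>C\<close>.\<close>
    let ?D = "range (\<lambda>k. (F ^^ k) \<beta>)"
    have "?D \<subseteq> C" using C_iter that by blast
    moreover have "F ` ?D \<subseteq> ?D"
    proof clarify
      fix k show "F ((F ^^ k) \<beta>) \<in> ?D" by (rule range_eqI[of _ _ "Suc k"]) simp
    qed
    moreover have "?D \<noteq> {}" by simp
    ultimately have "C = ?D" using C_minimal[of ?D] by simp
    then show ?thesis using that(2) by auto
  qed
  \<comment> \<open>The block of an out-neighbour \<open>y\<close> outside the union is not in
    \<open>C\<close>, so orbits in \<open>C\<close> never meet it and \<open>R_orbit\<close> carries
    \<open>y\<close> to every block of \<open>C\<close>.\<close>
  have U_mod: "out_module A S (\<Union>C)"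
    unfolding out_module_def
  proof (intro conjI ballI impI)
    show "\<Union>C \<subseteq> S" using C(1) Q_proper by blast
    show "\<Union>C \<noteq> {}" using C(1,2) Q_ne by blast
    fix x x' y assume x: "x \<in> \<Union>C" "x' \<in> \<Union>C" "y \<in> S - \<Union>C" "(x, y) \<in> A"
    then obtain \<beta> \<gamma> where \<beta>: "x \<in> \<beta>" "\<beta> \<in> C" "x' \<in> \<gamma>" "\<gamma> \<in> C" by blast
    then obtain k where k: "(F ^^ k) \<beta> = \<gamma>" using C_orbit[of \<beta> \<gamma>] by auto
    have "y \<in> R \<beta>" using x \<beta> by (auto simp: R_def)
    moreover have "(F ^^ j) \<beta> \<noteq> \<pi> y" for j
      using C_iter[OF \<beta>(2), of j] \<pi>_self[of y] x(3) by auto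
    ultimately have "y \<in> R \<gamma>" using R_orbit[of \<beta> y k] k \<beta>(2) C(1) by auto
    then show "(x', y) \<in> A" using R_out[of \<gamma> x' y] \<beta>(3,4) C(1) by auto
  qed
  \<comment> \<open>Otherwise \<open>C\<close> would be one block fixed by \<open>F\<close>, whereas
    \<open>g\<close> picks a vertex outside the block.\<close>
  have "\<Union>C \<noteq> \<pi> x" if "x \<in> S" for x
  proof
    assume eq: "\<Union>C = \<pi> x"
    have "\<beta> = \<pi> x" if "\<beta> \<in> C" for \<beta>
      using that eq C(1) Q_ne Q_\<pi> \<pi>_eq \<open>x \<in> S\<close> by (metis UnionI subsetD)
    then have "F (\<pi> x) = \<pi> x" "\<pi> x \<in> Q" using C by auto
    then show False using g_F by metis
  qed
  moreover have "\<pi> x \<subseteq> \<Union>C" if "x \<in> \<Union>C" for x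
    using that C(1) Q_\<pi> by blast
  ultimately have "\<Union>C = S" using prime[OF U_mod] by blast
  have "Q \<subseteq> C"
  proof
    fix \<beta> assume "\<beta> \<in> Q"
    then obtain x where "x \<in> \<beta>" "x \<in> S" using Q_ne Q_proper by blast
    then obtain \<gamma> where "\<gamma> \<in> C" "x \<in> \<gamma>" using \<open>\<Union>C = S\<close> by blast
    then show "\<beta> \<in> C" using Q_\<pi> \<open>\<beta> \<in> Q\<close> \<open>x \<in> \<beta>\<close> C(1) by blast
  qed
  then have orbit: "\<exists>k. (F ^^ k) \<beta> = \<gamma>" if "\<beta> \<in> Q" "\<gamma> \<in> Q" for \<beta> \<gamma>
    using C_orbit that by blast

  \<comment> \<open>Two-colouring the quotient\<close>
  define E where "E = {(\<beta>, \<gamma>). \<beta> \<in> Q \<and> (\<exists>y\<in>R \<beta>. \<gamma> = \<pi> y)}"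
  have "\<exists>Z\<subseteq>Q. B \<in> Z \<and> out_nbhd E B \<subseteq> Z \<and> induces_acyclic E Z \<and> induces_acyclic E (Q - Z)"
  proof (rule single_orbit_two_colouring[where f = F])
    show "E \<subseteq> Q \<times> Q" using R_D by (auto simp: E_def)
    \<comment> \<open>Vertices of a block share their outside out-neighbours, so opposite quotient
      arcs would join \<open>x\<close> and \<open>y\<close> both ways.\<close>
    show "(\<gamma>, \<beta>) \<notin> E" if "(\<beta>, \<gamma>) \<in> E" for \<beta> \<gamma>
    proof
      assume "(\<gamma>, \<beta>) \<in> E"
      then obtain x where x: "\<gamma> \<in> Q" "x \<in> R \<gamma>" "\<beta> = \<pi> x" by (auto simp: E_def)
      obtain y where y: "\<beta> \<in> Q" "y \<in> R \<beta>" "\<gamma> = \<pi> y"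
        using \<open>(\<beta>, \<gamma>) \<in> E\<close> by (auto simp: E_def)
      have "x \<in> \<beta>" "y \<in> \<gamma>" using x y R_D \<pi>_self by auto
      then show False using R_out[OF y(1) _ y(2)] R_out[OF x(1) _ x(2)] asym by auto
    qed
    show "(\<beta>, F \<beta>) \<in> E" if "\<beta> \<in> Q" for \<beta>
      using that g_R by (auto simp: E_def F_def)
    show "\<gamma> = F \<beta> \<or> (F \<beta>, \<gamma>) \<in> E" if "(\<beta>, \<gamma>) \<in> E" for \<beta> \<gamma>
    proof -
      obtain y where y: "\<beta> \<in> Q" "y \<in> R \<beta>" "\<gamma> = \<pi> y"
        using \<open>(\<beta>, \<gamma>) \<in> E\<close> by (auto simp: E_def)
      then show ?thesis using R_carry[OF y(1,2)] g_F(2) unfolding E_def by auto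
    qed
  qed (use \<open>finite Q\<close> \<open>B \<in> Q\<close> orbit in auto)
  then obtain Z where Z: "Z \<subseteq> Q" "B \<in> Z" "out_nbhd E B \<subseteq> Z"
    "induces_acyclic E Z" "induces_acyclic E (Q - Z)" by blast

  \<comment> \<open>Entries of a block\<close>
  have F_surj: "\<exists>\<delta>\<in>Q. F \<delta> = \<gamma>" if "\<gamma> \<in> Q" for \<gamma>
  proof -
    obtain k where "(F ^^ k) (F \<gamma>) = \<gamma>"
      using orbit g_F(2) \<open>\<gamma> \<in> Q\<close> by blast
    then have "F ((F ^^ k) \<gamma>) = \<gamma>" by (simp add: funpow_swap1)
    then show ?thesis using F_iter that by blast
  qed
  \<comment> \<open>Whatever block \<open>\<pi> y\<close> is entered from, it is entered in the closed out-neighbourhood of the same \<open>g \<delta>\<close>.\<close>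
  then have "inj_on F Q" using finite_surj_inj[OF \<open>finite Q\<close>, of F] by blast
  have entry: "y = g \<delta> \<or> (g \<delta>, y) \<in> A"
    if "\<beta> \<in> Q" "y \<in> R \<beta>" "\<delta> \<in> Q" "F \<delta> = \<pi> y" for \<beta> \<delta> y
  proof -
    \<comment> \<open>At the first arrival at \<open>\<pi> y\<close>, the preceding block is
      \<open>\<delta>\<close> by injectivity of \<open>F\<close>. Until then \<open>y\<close> is
      carried along, so it lies in \<open>R \<delta>\<close>, whose source is
      \<open>g \<delta>\<close>.\<close>
    define k where "k = (LEAST k. (F ^^ k) \<beta> = \<pi> y)"
    have k: "(F ^^ k) \<beta> = \<pi> y"
      using LeastI_ex[OF orbit[of \<beta> "\<pi> y", OF that(1)]] R_D[OF that(2)] unfolding k_def by simp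
    have "\<beta> \<noteq> \<pi> y" using R_D[OF that(2)] \<pi>_self by auto
    then obtain i where i: "k = Suc i" using k by (cases k) auto
    have "(F ^^ j) \<beta> \<noteq> \<pi> y" if "j \<le> i" for j
      using not_less_Least[of j "\<lambda>k. (F ^^ k) \<beta> = \<pi> y"] that i unfolding k_def by simp
    then have "y \<in> R ((F ^^ i) \<beta>)" by (rule R_orbit[OF that(1,2)])
    moreover have "(F ^^ i) \<beta> = \<delta>"
      using inj_onD[OF \<open>inj_on F Q\<close>, of "(F ^^ i) \<beta>" \<delta>] that(1,3,4) k i F_iter by simp
    ultimately show ?thesis using g_dom[OF \<open>\<delta> \<in> Q\<close>] by blast
  qed
  \<comment> \<open>\<open>B\<close> is coloured around \<open>v\<close>, as the claim for
    \<open>v\<close> demands; any other block around \<open>g \<delta>\<close> for its preimage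
    \<open>\<delta>\<close> under \<open>F\<close>, which puts all entries in one class.\<close>
  have "\<exists>T u. splits \<gamma> u T \<and> (\<gamma> = B \<longrightarrow> u = v) \<and>
      (\<gamma> \<noteq> B \<longrightarrow> (\<forall>\<beta>\<in>Q. R \<beta> \<inter> \<gamma> \<subseteq> T))" if \<gamma>: "\<gamma> \<in> Q" for \<gamma>
  proof (cases "\<gamma> = B")
    case True
    then obtain T where "splits \<gamma> v T" using IH[OF Q_proper[OF \<gamma>], of v] B(2) by auto
    then show ?thesis using True by auto
  next
    case False
    obtain \<delta> where \<delta>: "\<delta> \<in> Q" "F \<delta> = \<gamma>" using F_surj \<gamma> by blast
    then have "g \<delta> \<in> \<gamma>" using g_F(1) by auto
    then obtain T where T: "splits \<gamma> (g \<delta>) T" using IH[OF Q_proper[OF \<gamma>]] by auto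
    have "y \<in> T" if "\<beta> \<in> Q" "y \<in> R \<beta>" "y \<in> \<gamma>" for y \<beta>
      using entry[OF that(1,2) \<delta>(1)] \<delta>(2) Q_\<pi>[OF \<gamma> that(3)] T that(3)
      by (auto simp: splits_def out_nbhd_def)
    then show ?thesis using T False by auto
  qed
  then obtain t u where t: "\<And>\<gamma>. \<gamma> \<in> Q \<Longrightarrow> splits \<gamma> (u \<gamma>) (t \<gamma>)" "u B = v"
    and t_entry: "\<And>\<beta> \<gamma>. \<gamma> \<in> Q \<Longrightarrow> \<gamma> \<noteq> B \<Longrightarrow> \<beta> \<in> Q \<Longrightarrow> R \<beta> \<inter> \<gamma> \<subseteq> t \<gamma>"
    using \<open>B \<in> Q\<close> by metis

  \<comment> \<open>Combining the colourings of the blocks\<close>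
  have cross: "y \<in> R (\<pi> x) \<and> (\<pi> x, \<pi> y) \<in> E \<and> (\<pi> y \<noteq> B \<longrightarrow> y \<in> t (\<pi> y))"
    if "x \<in> S" "y \<in> S" "(x, y) \<in> A" "\<pi> x \<noteq> \<pi> y" for x y
  proof -
    have "y \<notin> \<pi> x" using \<pi>_eq that by metis
    then have "y \<in> R (\<pi> x)" using that \<pi>_self by (auto simp: R_def)
    moreover have "\<pi> x \<in> Q" "\<pi> y \<in> Q" using that by (auto simp: Q_def)
    ultimately show ?thesis using t_entry[of "\<pi> y" "\<pi> x"] \<pi>_self[OF \<open>y \<in> S\<close>] by (auto simp: E_def)
  qed
  have fibre: "acyclic (induced_arcs A X \<inter> {x. \<pi> x = b} \<times> {x. \<pi> x = b})"
    if "X \<subseteq> S" "b \<in> Q \<Longrightarrow> X \<inter> b \<subseteq> t b \<or> X \<inter> b \<subseteq> b - t b" for X b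
  proof -
    have sub: "induced_arcs A X \<inter> {x. \<pi> x = b} \<times> {x. \<pi> x = b} \<subseteq> induced_arcs A (X \<inter> b)"
      using \<open>X \<subseteq> S\<close> \<pi>_self by (auto simp: induced_arcs_def)
    show ?thesis
    proof (cases "b \<in> Q")
      case True
      then have "induces_acyclic A (X \<inter> b)"
        using that(2) t(1)[OF True] induces_acyclic_subset unfolding splits_def by blast
      then show ?thesis using sub unfolding induces_acyclic_def by (rule acyclic_subset)
    next
      case False
      then have "induced_arcs A X \<inter> {x. \<pi> x = b} \<times> {x. \<pi> x = b} = {}"
        using \<open>X \<subseteq> S\<close> by (auto simp: induced_arcs_def Q_def)
      then show ?thesis by (metis acyclic_if_decreasing empty_iff)
    qed
  qed
  \<comment> \<open>Cycles through several blocks enter them all. The entries of a block other than \<open>B\<close> have the colour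
    of the block; those of \<open>B\<close> may have both, but no arc leaves \<open>B\<close> within the second colour class.\<close>
  define T where "T = {x \<in> S. \<pi> x \<in> Z \<longleftrightarrow> x \<in> t (\<pi> x)}"
  \<comment> \<open>The two classes are swapped on blocks outside \<open>Z\<close>, so
    \<open>t b\<close> always gets the colour of \<open>b\<close>.\<close>
  have T_fibre: "x \<in> T \<longleftrightarrow> (b \<in> Z \<longleftrightarrow> x \<in> t b)" if "b \<in> Q" "x \<in> b" for x b
    using that Q_\<pi> Q_proper unfolding T_def by blast
  have "v \<in> T" using \<open>v \<in> S\<close> \<pi>_v Z t(1)[OF \<open>B \<in> Q\<close>] t(2) by (simp add: T_def splits_def)
  \<comment> \<open>The block of \<open>y\<close> is in \<open>Z\<close> by the choice of
    \<open>Z\<close>, and \<open>y\<close> is one of its entries. This settles the out-neighbours of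
    \<open>v\<close> outside \<open>B\<close> and bars arcs leaving \<open>B\<close> within
    \<open>S - T\<close>.\<close>
  have B_out: "y \<in> T" if "y \<in> R B" for y
  proof -
    have "\<pi> y \<in> Z" using that \<open>B \<in> Q\<close> Z(3) by (auto simp: E_def out_nbhd_def)
    moreover have "y \<in> \<pi> y" "\<pi> y \<noteq> B" "\<pi> y \<in> Q" using R_D[OF that] \<pi>_self by auto
    ultimately show ?thesis using t_entry[of "\<pi> y" B] that \<open>B \<in> Q\<close> R_D[OF that] by (auto simp: T_def)
  qed
  have "out_nbhd A v \<inter> S \<subseteq> T"
  proof
    fix y assume y: "y \<in> out_nbhd A v \<inter> S"
    show "y \<in> T"
    proof (cases "y \<in> B")
      case True
      then have "y \<in> t B" using y t(1)[OF \<open>B \<in> Q\<close>] t(2) unfolding splits_def by blast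
      then show ?thesis using T_fibre[OF \<open>B \<in> Q\<close> True] Z by blast
    next
      case False
      then show ?thesis using B_out y B(2) by (auto simp: R_def out_nbhd_def)
    qed
  qed
  moreover have "induces_acyclic A T"
    unfolding induces_acyclic_def
  proof (rule acyclic_if_fibres_acyclic[where \<pi> = \<pi>])
    \<comment> \<open>An arc within \<open>T\<close> into a block other than \<open>B\<close> ends
      at an entry in \<open>T\<close>, so that block is in \<open>Z\<close>, as is \<open>B\<close>.
      The block of the tail may be outside \<open>Z\<close>.\<close>
    show "acyclic {(\<beta>, \<gamma>) \<in> E. \<gamma> \<in> Z}"
      by (rule acyclic_if_inner_acyclic[OF Z(4)[unfolded induces_acyclic_def induced_arcs_def]]) auto
    show "acyclic (induced_arcs A T \<inter> {x. \<pi> x = b} \<times> {x. \<pi> x = b})" for b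
      by (rule fibre) (use T_fibre in \<open>auto simp: T_def\<close>)
    show "(\<pi> x, \<pi> y) \<in> {(\<beta>, \<gamma>) \<in> E. \<gamma> \<in> Z}"
      if "(x, y) \<in> induced_arcs A T" "\<pi> x \<noteq> \<pi> y" for x y
      using cross[of x y] that Z by (auto simp: T_def induced_arcs_def)
  qed
  moreover have "induces_acyclic A (S - T)"
    unfolding induces_acyclic_def
  proof (rule acyclic_if_fibres_acyclic[where \<pi> = \<pi>])
    \<comment> \<open>\<open>B\<close> is a sink here, so vertices that are both head and tail lie
      in \<open>Q - Z\<close>.\<close>
    show "acyclic {(\<beta>, \<gamma>) \<in> E. \<beta> \<noteq> B \<and> (\<gamma> \<in> Z \<longrightarrow> \<gamma> = B)}"
      by (rule acyclic_if_inner_acyclic[OF Z(5)[unfolded induces_acyclic_def induced_arcs_def]])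
        (auto simp: E_def)
    show "acyclic (induced_arcs A (S - T) \<inter> {x. \<pi> x = b} \<times> {x. \<pi> x = b})" for b
      by (rule fibre) (use T_fibre in auto)
    show "(\<pi> x, \<pi> y) \<in> {(\<beta>, \<gamma>) \<in> E. \<beta> \<noteq> B \<and> (\<gamma> \<in> Z \<longrightarrow> \<gamma> = B)}"
      if "(x, y) \<in> induced_arcs A (S - T)" "\<pi> x \<noteq> \<pi> y" for x y
      using cross[of x y] that B_out by (auto simp: T_def induced_arcs_def)
  qed
  moreover have "T \<subseteq> S" by (auto simp: T_def)
  ultimately have "splits S v T" using \<open>v \<in> T\<close> by (simp add: splits_def)
  then show ?thesis ..
qed

lemma splits_exists:
  assumes "finite S" "v \<in> S"
  shows "\<exists>T. splits S v T"
  using assms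
proof (induction S arbitrary: v rule: finite_psubset_induct)
  case (psubset S)
  have IH: "\<exists>T. splits S' u T" if "S' \<subset> S" "u \<in> S'" for S' u
    using psubset.IH that by simp
  show ?case
  proof (cases "\<exists>C\<subset>S. C \<noteq> {} \<and> (\<forall>x\<in>C. \<forall>y\<in>S - C. (x, y) \<notin> A)")
    case True
    then obtain C where C: "C \<subset> S" "C \<noteq> {}" "\<And>x y. x \<in> C \<Longrightarrow> y \<in> S - C \<Longrightarrow> (x, y) \<notin> A"
      by auto
    show ?thesis
      by (rule splits_closed[OF \<open>finite S\<close> C IH \<open>v \<in> S\<close>])
  next
    case strong: False
    show ?thesis
    proof (cases "S = {v}")
      case True
      have "induced_arcs A {v} = {}" "induced_arcs A {} = {}"
        using asym by (auto simp: induced_arcs_def)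
      then have "splits S v {v}"
        using True by (simp add: splits_def induces_acyclic_def acyclic_def)
      then show ?thesis ..
    next
      case False
      show ?thesis
      proof (rule splits_strong[OF \<open>finite S\<close> \<open>v \<in> S\<close> False _ IH])
        show "\<exists>x\<in>C. \<exists>y\<in>S - C. (x, y) \<in> A" if "C \<subset> S" "C \<noteq> {}" for C
          using strong that by auto
      qed
    qed
  qed
qed

end

theorem theorem3p2:
  fixes V :: "'a set" and A :: "('a \<times> 'a) set"
  assumes "oriented_graph V A"
    and "\<forall>x\<in>V. induces_transitive_tournament A (out_nbhd A x)"
  shows "dichromatic_le V A 2"
proof -
  have V: "finite V" "A \<subseteq> V \<times> V" using assms(1) by (auto simp: oriented_graph_def)
  interpret out_transitive A
  proof
    show "(y, x) \<notin> A" if "(x, y) \<in> A" for x y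
      using assms(1) that by (auto simp: oriented_graph_def)
    show "induces_transitive_tournament A (out_nbhd A x)" for x
    proof (cases "x \<in> V")
      case False
      then have "out_nbhd A x = {}" using V by (auto simp: out_nbhd_def)
      then show ?thesis
        by (simp add: induces_transitive_tournament_def induces_tournament_def
            induces_acyclic_def induced_arcs_def acyclic_def)
    qed (use assms(2) in blast)
  qed
  obtain T where T: "T \<subseteq> V" "induces_acyclic A T" "induces_acyclic A (V - T)"
  \<comment> \<open>With no vertices there is no \<open>v\<close> to start from.\<close>
  proof (cases "V = {}")
    case True
    then show ?thesis
      using that[of "{}"] by (simp add: induces_acyclic_def induced_arcs_def acyclic_def)
  next
    case False
    then show ?thesis using that splits_exists[OF V(1)] unfolding splits_def by blast
  qed
  define c :: "'a \<Rightarrow> nat" where "c x = (if x \<in> T then 0 else 1)" for x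
  have "{x \<in> V. c x = 0} = T" "{x \<in> V. c x = 1} = V - T" using T(1) by (auto simp: c_def)
  then have "induces_acyclic A {x \<in> V. c x = i}" if "i < 2" for i
    using that T less_2_cases[of i] by auto
  moreover have "\<forall>x\<in>V. c x < 2" by (simp add: c_def)
  ultimately show ?thesis unfolding dichromatic_le_def by blast
qed

end
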